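(* Being invariantly finitely $L$-presented is an abstract property of a group which does not depend on the generating set; that is: if a group $G$ admits an invariant finite $L$-presentation (with respect to some finite generating set), then for every finite generating set $\mathcal Y$ of $G$, the group $G$ admits an invariant finite $L$-presentation with respect to the generating set $\mathcal Y$.
   Context: Endomorphisms act on the right, written $g\mapsto g^\sigma$. For an alphabet $\mathcal X$, $F(\mathcal X)$ is the free group over $\mathcal X$; $\langle A\rangle^F$ is the normal closure of $A$ in $F$. An $L$-presentation $\langle\mathcal X\mid\mathcal Q\mid\Phi\mid\mathcal R\rangle$ consists of an alphabet $\mathcal X$ (generators), subsets $\mathcal Q$ (fixed relations) and $\mathcal R$ (iterated relations) of $F=F(\mathcal X)$, and a subset $\Phi\subseteq\mathrm{End}(F)$ (substitutions). With $\Phi^*\subseteq\mathrm{End}(F)$ the monoid generated by $\Phi$, it defines the group $F/K$ where $K=\langle\mathcal Q\cup\bigcup_{\sigma\in\Phi^*}\mathcal R^\sigma\rangle^F$. It is finite if $\mathcal X,\mathcal Q,\Phi,\mathcal R$ are finite. It is invariant if each $\varphi\in\Phi$ induces an endomorphism of the group, i.e. $K^\varphi\subseteq K$. An $L$-presentation of $G$ with respect to a generating set $\mathcal Y$ of $G$ is an $L$-presentation with alphabet $\mathcal Y$ such that the kernel of the natural epimorphism $F(\mathcal Y)\to G$, $y\mapsto y$, is the normal subgroup $K$ of $F(\mathcal Y)$ determined by the $L$-presentation. *)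

theory Defs
  imports "HOL-Algebra.Generated_Groups"
begin

section \<open>Free groups\<close>

text \<open>The pair \<open>(x, True)\<close> stands for the letter \<open>x\<close>, and \<open>(x, False)\<close> for its formal inverse.
  Elements of the free group are the freely reduced words.\<close>

type_synonym 'a fword = "('a \<times> bool) list"

definition inv_letter :: "'a \<times> bool \<Rightarrow> 'a \<times> bool" where
  "inv_letter a = (fst a, \<not> snd a)"

definition reduced :: "'a fword \<Rightarrow> bool" where
  "reduced w \<longleftrightarrow> successively (\<lambda>a b. b \<noteq> inv_letter a) w"

fun red_cons :: "'a \<times> bool \<Rightarrow> 'a fword \<Rightarrow> 'a fword" where
  "red_cons a [] = [a]"
| "red_cons a (b # w) = (if b = inv_letter a then w else a # b # w)"

definition free_group :: "'a set \<Rightarrow> 'a fword monoid" where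
  "free_group X =
     \<lparr>carrier = {w. fst ` set w \<subseteq> X \<and> reduced w}, mult = foldr red_cons, one = []\<rparr>"

definition letter_eval :: "('a, 'b) monoid_scheme \<Rightarrow> 'a \<times> bool \<Rightarrow> 'a" where
  "letter_eval G a = (if snd a then fst a else inv\<^bsub>G\<^esub> (fst a))"

text \<open>The natural homomorphism from the free group over a subset of \<open>G\<close> to \<open>G\<close>.\<close>

definition word_eval :: "('a, 'b) monoid_scheme \<Rightarrow> 'a fword \<Rightarrow> 'a" where
  "word_eval G w = foldr (\<lambda>a g. letter_eval G a \<otimes>\<^bsub>G\<^esub> g) w \<one>\<^bsub>G\<^esub>"

lemma inv_letter_simps [simp]:
  "inv_letter (inv_letter a) = a" "fst (inv_letter a) = fst a"
  "inv_letter a \<noteq> a" "a \<noteq> inv_letter a"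
  by (auto simp: inv_letter_def prod_eq_iff)

lemma reduced_Nil [simp]: "reduced []"
  by (simp add: reduced_def)

lemma reduced_ConsD: "reduced (a # w) \<Longrightarrow> reduced w"
  by (cases w) (auto simp: reduced_def)

lemma reduced_red_cons: "reduced w \<Longrightarrow> reduced (red_cons a w)"
  by (cases w) (auto simp: reduced_def dest: reduced_ConsD[unfolded reduced_def])

lemma reduced_foldr: "reduced w \<Longrightarrow> reduced (foldr red_cons v w)"
  by (induction v) (simp_all add: reduced_red_cons)

lemma red_cons_cancel: "reduced w \<Longrightarrow> red_cons a (red_cons (inv_letter a) w) = w"
proof (cases w)
  case (Cons b v)
  then show "reduced w \<Longrightarrow> ?thesis" by (cases v) (auto simp: reduced_def)
qed auto

lemma red_cons_reduced: "reduced (a # w) \<Longrightarrow> red_cons a w = a # w"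
  by (cases w) (auto simp: reduced_def)

lemma foldr_red_cons_Nil: "reduced w \<Longrightarrow> foldr red_cons w [] = w"
proof (induction w)
  case (Cons a w)
  then show ?case using reduced_ConsD[of a w] red_cons_reduced[of a w] by simp
qed simp

lemma foldr_red_cons_red_cons:
  "reduced z \<Longrightarrow> foldr red_cons (red_cons a v) z = red_cons a (foldr red_cons v z)"
  by (cases v) (auto simp: red_cons_cancel reduced_foldr)

lemma foldr_red_cons_assoc:
  "reduced z \<Longrightarrow>
   foldr red_cons (foldr red_cons x y) z = foldr red_cons x (foldr red_cons y z)"
  by (induction x) (auto simp: foldr_red_cons_red_cons)

lemma letters_red_cons: "fst ` set (red_cons a w) \<subseteq> insert (fst a) (fst ` set w)"
  by (cases w) auto

lemma letters_foldr_red_cons: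
  "fst ` set (foldr red_cons v w) \<subseteq> fst ` set v \<union> fst ` set w"
proof (induction v)
  case (Cons a v)
  then show ?case using letters_red_cons[of a "foldr red_cons v w"] by (simp add: subset_iff) blast
qed simp

lemma reduced_inverse: "reduced w \<Longrightarrow> reduced (map inv_letter (rev w))"
  unfolding reduced_def successively_map successively_rev
  by (erule successively_mono) (metis inv_letter_simps(1))

lemma foldr_red_cons_inverse: "foldr red_cons (map inv_letter (rev w)) w = []"
  by (induction w) auto

lemma group_free_group: "group (free_group X)"
proof (rule groupI)
  fix x y assume "x \<in> carrier (free_group X)" "y \<in> carrier (free_group X)"
  then show "x \<otimes>\<^bsub>free_group X\<^esub> y \<in> carrier (free_group X)"
    using letters_foldr_red_cons[of x y]
    by (simp add: free_group_def reduced_foldr) (meson Un_least order_trans)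
next
  fix x assume x: "x \<in> carrier (free_group X)"
  show "\<exists>y\<in>carrier (free_group X). y \<otimes>\<^bsub>free_group X\<^esub> x = \<one>\<^bsub>free_group X\<^esub>"
  proof (rule bexI[of _ "map inv_letter (rev x)"])
    show "map inv_letter (rev x) \<in> carrier (free_group X)"
      using x by (auto simp: free_group_def reduced_inverse)
  qed (simp add: free_group_def foldr_red_cons_inverse)
qed (auto simp: free_group_def foldr_red_cons_assoc)

lemma (in group) word_eval_hom:
  assumes "Y \<subseteq> carrier G"
  shows "word_eval G \<in> hom (free_group Y) G"
proof -
  have letter: "letter_eval G a \<in> carrier G" if "fst a \<in> Y" for a
    using that assms by (auto simp: letter_eval_def)
  have closed: "word_eval G w \<in> carrier G" if "fst ` set w \<subseteq> Y" for w
    using that by (induction w) (auto simp: word_eval_def letter)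
  have inverse: "letter_eval G a \<otimes> letter_eval G (inv_letter a) = \<one>" if "fst a \<in> Y" for a
    using that assms by (auto simp: letter_eval_def inv_letter_def)
  have step: "word_eval G (red_cons a w) = letter_eval G a \<otimes> word_eval G w"
    if "fst a \<in> Y" "fst ` set w \<subseteq> Y" for a w
  proof (cases w)
    case (Cons b v)
    then have v: "fst ` set v \<subseteq> Y" using that by auto
    have "word_eval G v = letter_eval G a \<otimes> (letter_eval G (inv_letter a) \<otimes> word_eval G v)"
      using that v by (simp add: m_assoc[symmetric] inverse letter closed)
    then show ?thesis using Cons by (simp add: word_eval_def)
  qed (simp add: word_eval_def)
  have "word_eval G (foldr red_cons v w) = word_eval G v \<otimes> word_eval G w"
    if "fst ` set v \<subseteq> Y" "fst ` set w \<subseteq> Y" for v w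
    using that
  proof (induction v)
    case Nil
    then show ?case using closed[of w] by (simp add: word_eval_def)
  next
    case (Cons a v)
    have "fst ` set (foldr red_cons v w) \<subseteq> Y"
      using letters_foldr_red_cons[of v w] Cons.prems
      by (meson Un_least order_trans set_subset_Cons image_mono)
    then have "word_eval G (foldr red_cons (a # v) w) =
        letter_eval G a \<otimes> (word_eval G v \<otimes> word_eval G w)"
      using Cons by (simp add: step)
    also have "\<dots> = word_eval G (a # v) \<otimes> word_eval G w"
      using Cons.prems closed[of v] closed[of w] letter[of a]
      by (simp add: m_assoc[symmetric]) (simp add: word_eval_def)
    finally show ?case .
  qed
  then show ?thesis using closed by (auto simp: hom_def free_group_def)
qed


section \<open>\<open>L\<close>-presentations\<close>

definition normal_closure :: "('a, 'b) monoid_scheme \<Rightarrow> 'a set \<Rightarrow> 'a set" where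
  "normal_closure F A = \<Inter> {N. N \<lhd> F \<and> A \<subseteq> N}"

text \<open>Endomorphisms are extensional functions, so that distinct elements of \<open>End F\<close> are
  distinct as maps on the carrier and finiteness of a set of endomorphisms is meaningful.\<close>

definition End :: "('a, 'b) monoid_scheme \<Rightarrow> ('a \<Rightarrow> 'a) set" where
  "End F = hom F F \<inter> extensional (carrier F)"

text \<open>The submonoid of \<open>End F\<close> generated by \<open>\<Phi>\<close>; for a right action, the product of \<open>\<sigma>\<close> and
  \<open>\<phi>\<close> applies \<open>\<sigma>\<close> first.\<close>

inductive_set generated_monoid ::
    "('a, 'b) monoid_scheme \<Rightarrow> ('a \<Rightarrow> 'a) set \<Rightarrow> ('a \<Rightarrow> 'a) set"
  for F and \<Phi> where
  identity: "(\<lambda>g\<in>carrier F. g) \<in> generated_monoid F \<Phi>"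
| product: "\<sigma> \<in> generated_monoid F \<Phi> \<Longrightarrow> \<phi> \<in> \<Phi> \<Longrightarrow>
    compose (carrier F) \<phi> \<sigma> \<in> generated_monoid F \<Phi>"

record 'a L_pres =
  gens :: "'a set"
  fixed_rels :: "'a fword set"
  substs :: "('a fword \<Rightarrow> 'a fword) set"
  iter_rels :: "'a fword set"

definition L_presentation :: "'a L_pres \<Rightarrow> bool" where
  "L_presentation P \<longleftrightarrow>
     fixed_rels P \<subseteq> carrier (free_group (gens P)) \<and>
     substs P \<subseteq> End (free_group (gens P)) \<and>
     iter_rels P \<subseteq> carrier (free_group (gens P))"

definition L_kernel :: "'a L_pres \<Rightarrow> 'a fword set" where
  "L_kernel P = normal_closure (free_group (gens P))
     (fixed_rels P \<union>
      (\<Union>\<sigma>\<in>generated_monoid (free_group (gens P)) (substs P). \<sigma> ` iter_rels P))"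

definition finite_L_pres :: "'a L_pres \<Rightarrow> bool" where
  "finite_L_pres P \<longleftrightarrow>
     finite (gens P) \<and> finite (fixed_rels P) \<and> finite (substs P) \<and> finite (iter_rels P)"

definition invariant_L_pres :: "'a L_pres \<Rightarrow> bool" where
  "invariant_L_pres P \<longleftrightarrow> (\<forall>\<phi>\<in>substs P. \<phi> ` L_kernel P \<subseteq> L_kernel P)"

definition generating_set :: "('a, 'b) monoid_scheme \<Rightarrow> 'a set \<Rightarrow> bool" where
  "generating_set G Y \<longleftrightarrow> Y \<subseteq> carrier G \<and> generate G Y = carrier G"

definition L_presentation_of ::
    "('a, 'b) monoid_scheme \<Rightarrow> 'a set \<Rightarrow> 'a L_pres \<Rightarrow> bool" where
  "L_presentation_of G Y P \<longleftrightarrow>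
     generating_set G Y \<and> L_presentation P \<and> gens P = Y \<and>
     kernel (free_group Y) G (word_eval G) = L_kernel P"

definition admits_invariant_finite_L_pres ::
    "('a, 'b) monoid_scheme \<Rightarrow> 'a set \<Rightarrow> bool" where
  "admits_invariant_finite_L_pres G Y \<longleftrightarrow>
     (\<exists>P. L_presentation_of G Y P \<and> finite_L_pres P \<and> invariant_L_pres P)"

end

theory Submission
  imports Defs
begin

text \<open>Let \<open>P\<close> be an invariant finite \<open>L\<close>-presentation of \<open>G\<close> with respect to \<open>X\<close>, with
  substitutions \<open>\<Phi>\<close>, and let \<open>Y\<close> be another finite generating set. Since free groups are
  projective, the identity of \<open>G\<close> lifts to homomorphisms \<open>a : F(X) \<rightarrow> F(Y)\<close> and
  \<open>b : F(Y) \<rightarrow> F(X)\<close> (\<open>change_of_generators_lift\<close>). The new presentation has the substitutions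
  \<open>a \<circ> \<phi> \<circ> b\<close>, and its relators are the images under \<open>a\<close> of all relators of \<open>P\<close>, the words
  \<open>a (b y) y\<^sup>-\<^sup>1\<close>, and the words \<open>a (\<phi> x) a (\<phi> (b (a x)))\<^sup>-\<^sup>1\<close>, for \<open>x\<close> in \<open>X\<close>, \<open>y\<close> in \<open>Y\<close> and
  \<open>\<phi>\<close> in \<open>\<Phi>\<close>. These are finitely many. All of them are iterated relators, and a presentation
  without fixed relators is invariant (\<open>no_fixed_rels_invariant\<close>).

  Let \<open>K\<close> be the kernel of \<open>F(X) \<rightarrow> G\<close>, and \<open>N\<close> the normal subgroup of \<open>F(Y)\<close> that the new
  presentation determines. Every new relator is trivial in \<open>G\<close>; for the last family this
  uses that \<open>\<phi>\<close> induces an endomorphism of \<open>G\<close>, that is, the invariance of \<open>P\<close>. The kernel of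
  \<open>F(Y) \<rightarrow> G\<close> is stable under \<open>a \<circ> \<phi> \<circ> b\<close> for the same reason, so it contains \<open>N\<close>. For the
  converse, the last family gives \<open>a (\<phi> w) \<equiv> a (\<phi> (b (a w)))\<close> modulo \<open>N\<close> for all \<open>w\<close>, because it
  does so on letters. As \<open>N\<close> is stable under the new substitutions, the preimage of \<open>N\<close> under \<open>a\<close>
  is a normal subgroup that is stable under \<open>\<Phi>\<close> and contains the relators of \<open>P\<close>; hence it
  contains \<open>K\<close> (\<open>a_L_kernel\<close>). If \<open>h\<close> in \<open>F(Y)\<close> is trivial in \<open>G\<close>, then \<open>b h\<close> lies in \<open>K\<close>, so
  \<open>a (b h)\<close> lies in \<open>N\<close>, and \<open>a (b h) \<equiv> h\<close> modulo \<open>N\<close> by the middle family.\<close>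

section \<open>Homomorphisms and normal subgroups\<close>

lemma (in group) normal_vimage:
  assumes F: "group F" and f: "f \<in> hom F G" and N: "N \<lhd> G"
  shows "{w \<in> carrier F. f w \<in> N} \<lhd> F"
proof -
  interpret N: normal N G by (rule N)
  interpret f: group_hom F "G Mod N" "(#>) N \<circ> f"
    using F f N.r_coset_hom_Mod N.factorgroup_is_group
    by (auto simp: group_hom_def group_hom_axioms_def intro: Group.hom_compose)
  have "{w \<in> carrier F. f w \<in> N} = kernel F (G Mod N) ((#>) N \<circ> f)"
    using hom_carrier[OF f] N.subgroup_axioms coset_join1[of N] coset_join2[of _ N]
    by (auto simp: kernel_def)
  then show ?thesis using f.normal_kernel by simp
qed

lemma normal_Inter:
  assumes "group F" "\<N> \<noteq> {}" "\<And>N. N \<in> \<N> \<Longrightarrow> N \<lhd> F"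
  shows "\<Inter>\<N> \<lhd> F"
proof -
  interpret group F by fact
  have "subgroup N F" if "N \<in> \<N>" for N using assms(3)[OF that] by (rule normal_imp_subgroup)
  then have "subgroup (\<Inter>\<N>) F" using assms(2) by (intro subgroups_Inter) auto
  moreover have "x \<otimes>\<^bsub>F\<^esub> h \<otimes>\<^bsub>F\<^esub> inv\<^bsub>F\<^esub> x \<in> N"
    if "x \<in> carrier F" "h \<in> \<Inter>\<N>" "N \<in> \<N>" for x h N
    using assms(3)[OF that(3)] that by (auto simp: normal_inv_iff)
  ultimately show ?thesis by (simp add: normal_inv_iff)
qed

lemma normal_closure_normal:
  assumes "group F" "A \<subseteq> carrier F"
  shows "normal_closure F A \<lhd> F"
  unfolding normal_closure_def
  using assms group.normal_self[OF assms(1)] by (intro normal_Inter) auto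

lemma normal_closure_incl: "A \<subseteq> normal_closure F A"
  by (auto simp: normal_closure_def)

lemma normal_closure_least: "N \<lhd> F \<Longrightarrow> A \<subseteq> N \<Longrightarrow> normal_closure F A \<subseteq> N"
  by (auto simp: normal_closure_def)

section \<open>The universal property of free groups\<close>

lemma letter_in_free_group: "x \<in> X \<Longrightarrow> [(x, b)] \<in> carrier (free_group X)"
  by (simp add: free_group_def reduced_def)

lemma inv_letter_free_group:
  assumes "x \<in> X"
  shows "inv\<^bsub>free_group X\<^esub> [(x, True)] = [(x, False)]"
proof -
  interpret group "free_group X" by (rule group_free_group)
  show ?thesis
    using assms by (intro inv_equality letter_in_free_group)
      (auto simp: free_group_def inv_letter_def)
qed

lemma free_group_generated_by_letters:
  assumes H: "subgroup H (free_group X)" and letters: "\<And>x. x \<in> X \<Longrightarrow> [(x, True)] \<in> H"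
  shows "carrier (free_group X) \<subseteq> H"
proof
  fix w assume "w \<in> carrier (free_group X)"
  then show "w \<in> H"
  proof (induction w)
    case Nil
    then show ?case using subgroup.one_closed[OF H] by (simp add: free_group_def)
  next
    case (Cons a w)
    obtain x b where a: "a = (x, b)" by fastforce
    have x: "x \<in> X" and red: "reduced (a # w)" and w: "w \<in> H"
      using Cons a by (auto simp: free_group_def dest: reduced_ConsD)
    have "[a] \<in> H"
      using letters[OF x] subgroup.m_inv_closed[OF H letters[OF x]]
      by (cases b) (simp_all add: a x inv_letter_free_group)
    then have "[a] \<otimes>\<^bsub>free_group X\<^esub> w \<in> H" using w by (rule subgroup.m_closed[OF H])
    then show ?case using red_cons_reduced[OF red] by (simp add: free_group_def)
  qed
qed

lemma (in group) free_group_hom_unique: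
  assumes f: "f \<in> hom (free_group X) G" and g: "g \<in> hom (free_group X) G"
    and eq: "\<And>x. x \<in> X \<Longrightarrow> f [(x, True)] = g [(x, True)]"
    and w: "w \<in> carrier (free_group X)"
  shows "f w = g w"
proof -
  interpret F: group "free_group X" by (rule group_free_group)
  interpret f: group_hom "free_group X" G f by unfold_locales (rule f)
  interpret g: group_hom "free_group X" G g by unfold_locales (rule g)
  have "subgroup {w \<in> carrier (free_group X). f w = g w} (free_group X)"
    by (rule F.subgroupI) auto
  from free_group_generated_by_letters[OF this] w show ?thesis
    using eq letter_in_free_group by fastforce
qed

text \<open>Both homomorphisms become equal after projection to the quotient by \<open>N\<close>, since they do so on
  letters. This is how finitely many relators control all words.\<close>

lemma (in group) free_group_hom_congruent:
  assumes f: "f \<in> hom (free_group X) G" and g: "g \<in> hom (free_group X) G"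
    and N: "N \<lhd> G"
    and eq: "\<And>x. x \<in> X \<Longrightarrow> f [(x, True)] \<otimes> inv (g [(x, True)]) \<in> N"
    and w: "w \<in> carrier (free_group X)"
  shows "f w \<in> N \<longleftrightarrow> g w \<in> N"
proof -
  interpret N: normal N G by (rule N)
  interpret Q: group "G Mod N" by (rule N.factorgroup_is_group)
  have in_G: "f v \<in> carrier G" "g v \<in> carrier G" if "v \<in> carrier (free_group X)" for v
    using that f g by (auto simp: hom_def)
  have "((#>) N \<circ> f) w = ((#>) N \<circ> g) w"
  proof (rule Q.free_group_hom_unique[OF _ _ _ w])
    fix x assume x: "x \<in> X"
    have "f [(x, True)] \<in> N #> g [(x, True)]"
      using x eq by (intro N.rcos_module_rev) (auto simp: in_G letter_in_free_group is_group)
    then show "((#>) N \<circ> f) [(x, True)] = ((#>) N \<circ> g) [(x, True)]"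
      using repr_independence[OF _ in_G(2)[OF letter_in_free_group[OF x]] N.subgroup_axioms] by simp
  qed (rule Group.hom_compose[OF f N.r_coset_hom_Mod] Group.hom_compose[OF g N.r_coset_hom_Mod])+
  then have eq': "N #> f w = N #> g w" by simp
  have "N #> v = N \<longleftrightarrow> v \<in> N" if "v \<in> carrier G" for v
    using that N.subgroup_axioms coset_join1 coset_join2 by blast
  with in_G[OF w] eq' show ?thesis by metis
qed

text \<open>The value is defined on all words, reduced or not, by multiplying out the images of the
  letters; \<open>free_extension_hom\<close> rests on the fact that cancelling a pair of inverse letters does
  not change it.\<close>

definition free_extension :: "('b, 'c) monoid_scheme \<Rightarrow> ('a \<Rightarrow> 'b) \<Rightarrow> 'a fword \<Rightarrow> 'b" where
  "free_extension G f w =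
     foldr (\<lambda>a g. (if snd a then f (fst a) else inv\<^bsub>G\<^esub> (f (fst a))) \<otimes>\<^bsub>G\<^esub> g) w \<one>\<^bsub>G\<^esub>"

lemma (in group) free_extension_letter:
  "f x \<in> carrier G \<Longrightarrow> free_extension G f [(x, True)] = f x"
  by (simp add: free_extension_def)

lemma (in group) free_extension_hom:
  assumes f: "f \<in> X \<rightarrow> carrier G"
  shows "free_extension G f \<in> hom (free_group X) G"
proof -
  define l where "l a = (if snd a then f (fst a) else inv (f (fst a)))" for a
  have ext: "free_extension G f w = foldr (\<lambda>a g. l a \<otimes> g) w \<one>" for w
    by (simp add: free_extension_def l_def)
  have l: "l a \<in> carrier G" "l a \<otimes> l (inv_letter a) = \<one>" if "fst a \<in> X" for a
    using that f by (auto simp: l_def inv_letter_def Pi_iff)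
  have closed: "free_extension G f w \<in> carrier G" if "fst ` set w \<subseteq> X" for w
    using that by (induction w) (auto simp: ext l)
  have step: "free_extension G f (red_cons a w) = l a \<otimes> free_extension G f w"
    if "fst a \<in> X" "fst ` set w \<subseteq> X" for a w
  proof (cases w)
    case (Cons b v)
    have "free_extension G f v = l a \<otimes> (l (inv_letter a) \<otimes> free_extension G f v)"
      using that Cons closed[of v] by (simp add: m_assoc[symmetric] l)
    then show ?thesis using Cons by (simp add: ext)
  qed (simp add: ext)
  have "free_extension G f (foldr red_cons v w) = free_extension G f v \<otimes> free_extension G f w"
    if "fst ` set v \<subseteq> X" "fst ` set w \<subseteq> X" for v w
    using that(1)
  proof (induction v)
    case Nil
    then show ?case using closed[OF that(2)] by (simp add: ext[of "[]"])
  next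
    case (Cons a v)
    have "fst ` set (foldr red_cons v w) \<subseteq> X"
      using letters_foldr_red_cons[of v w] Cons.prems that(2) by (simp add: subset_iff) blast
    then show ?case
      using Cons closed[of v] closed[OF that(2)]
      by (simp add: step m_assoc l) (simp add: ext m_assoc l)
  qed
  then show ?thesis using closed by (auto simp: hom_def free_group_def)
qed

section \<open>Generating sets and lifts of the identity\<close>

lemma (in group) word_eval_letter: "x \<in> carrier G \<Longrightarrow> word_eval G [(x, True)] = x"
  by (simp add: word_eval_def letter_eval_def)

lemma (in group) word_eval_surj:
  assumes "generating_set G Y"
  shows "carrier G \<subseteq> word_eval G ` carrier (free_group Y)"
proof -
  have Y: "Y \<subseteq> carrier G" "generate G Y = carrier G"
    using assms by (auto simp: generating_set_def)
  interpret e: group_hom "free_group Y" G "word_eval G"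
    using word_eval_hom[OF Y(1)] group_free_group by (simp add: group_hom_def group_hom_axioms_def)
  have "Y \<subseteq> word_eval G ` carrier (free_group Y)"
  proof
    fix y assume "y \<in> Y"
    then show "y \<in> word_eval G ` carrier (free_group Y)"
      using word_eval_letter[of y] Y(1) by (intro image_eqI[OF _ letter_in_free_group[of y Y True]]) auto
  qed
  then show ?thesis
    using generate_subgroup_incl[OF _ e.img_is_subgroup, of Y] Y(2) by simp
qed

text \<open>Free groups are projective: each letter goes to some word over \<open>Y\<close> that represents it.\<close>

lemma (in group) change_of_generators_lift:
  assumes X: "X \<subseteq> carrier G" and Y: "generating_set G Y"
  obtains a where "a \<in> hom (free_group X) (free_group Y)"
    "\<And>w. w \<in> carrier (free_group X) \<Longrightarrow> word_eval G (a w) = word_eval G w"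
proof -
  interpret H: group "free_group Y" by (rule group_free_group)
  have "\<forall>x\<in>X. \<exists>w. w \<in> carrier (free_group Y) \<and> word_eval G w = x"
    using word_eval_surj[OF Y] X by blast
  then obtain s where s: "\<And>x. x \<in> X \<Longrightarrow> s x \<in> carrier (free_group Y)"
    "\<And>x. x \<in> X \<Longrightarrow> word_eval G (s x) = x"
    by metis
  let ?a = "free_extension (free_group Y) s"
  have a: "?a \<in> hom (free_group X) (free_group Y)"
    using s by (intro H.free_extension_hom) auto
  have "(word_eval G \<circ> ?a) w = word_eval G w" if "w \<in> carrier (free_group X)" for w
  proof (rule free_group_hom_unique[OF _ _ _ that])
    show "word_eval G \<circ> ?a \<in> hom (free_group X) G"
      using a Y by (auto simp: generating_set_def intro: Group.hom_compose word_eval_hom)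
    show "word_eval G \<in> hom (free_group X) G" by (rule word_eval_hom[OF X])
  qed (use s X in \<open>auto simp: H.free_extension_letter word_eval_letter\<close>)
  then show thesis using that a by simp
qed

section \<open>The kernel of an L-presentation\<close>

lemma (in group) generated_monoid_hom:
  assumes "\<Phi> \<subseteq> End G" "\<sigma> \<in> generated_monoid G \<Phi>"
  shows "\<sigma> \<in> hom G G"
  using assms(2)
proof induction
  case identity
  then show ?case by (auto simp: hom_def)
next
  case (product \<sigma> \<phi>)
  then have "\<phi> \<in> hom G G" using assms(1) by (auto simp: End_def)
  with product.IH show ?case by (auto simp: hom_def compose_def Pi_iff)
qed

lemma L_relators_carrier:
  assumes "L_presentation P"
  shows "fixed_rels P \<union> (\<Union>\<sigma>\<in>generated_monoid (free_group (gens P)) (substs P). \<sigma> ` iter_rels P)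
    \<subseteq> carrier (free_group (gens P))"
proof -
  have "\<sigma> ` iter_rels P \<subseteq> carrier (free_group (gens P))"
    if "\<sigma> \<in> generated_monoid (free_group (gens P)) (substs P)" for \<sigma>
    using hom_carrier[OF group.generated_monoid_hom[OF group_free_group _ that]] assms
    unfolding L_presentation_def by blast
  then show ?thesis using assms unfolding L_presentation_def by blast
qed

lemma L_kernel_normal:
  assumes "L_presentation P"
  shows "L_kernel P \<lhd> free_group (gens P)"
  unfolding L_kernel_def
  by (rule normal_closure_normal[OF group_free_group L_relators_carrier[OF assms]])

lemma L_relators_L_kernel:
  "fixed_rels P \<union> (\<Union>\<sigma>\<in>generated_monoid (free_group (gens P)) (substs P). \<sigma> ` iter_rels P)
    \<subseteq> L_kernel P"
  unfolding L_kernel_def by (rule normal_closure_incl)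

lemma iter_rels_L_kernel:
  assumes "L_presentation P"
  shows "iter_rels P \<subseteq> L_kernel P"
proof
  fix r assume r: "r \<in> iter_rels P"
  let ?F = "free_group (gens P)"
  have "r = (\<lambda>g\<in>carrier ?F. g) r" using r assms by (auto simp: L_presentation_def)
  then have "r \<in> (\<Union>\<sigma>\<in>generated_monoid ?F (substs P). \<sigma> ` iter_rels P)"
    using r generated_monoid.identity[of ?F "substs P"] by blast
  then show "r \<in> L_kernel P" using L_relators_L_kernel[of P] by blast
qed

text \<open>Inclusion in a normal subgroup can be tested one substitution at a time, without reference
  to the generated monoid.\<close>

lemma L_kernel_least:
  assumes P: "L_presentation P" and N: "N \<lhd> free_group (gens P)"
    and rels: "fixed_rels P \<subseteq> N" "iter_rels P \<subseteq> N"
    and inv: "\<And>\<phi>. \<phi> \<in> substs P \<Longrightarrow> \<phi> ` N \<subseteq> N"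
  shows "L_kernel P \<subseteq> N"
proof -
  have "\<sigma> r \<in> N" if "\<sigma> \<in> generated_monoid (free_group (gens P)) (substs P)" "r \<in> iter_rels P"
    for \<sigma> r
    using that
  proof induction
    case identity
    then show ?case using rels P by (auto simp: L_presentation_def)
  next
    case (product \<sigma> \<phi>)
    then show ?case using inv[of \<phi>] P by (auto simp: L_presentation_def compose_def)
  qed
  then show ?thesis
    unfolding L_kernel_def using rels(1) by (intro normal_closure_least[OF N]) auto
qed

text \<open>If all relators are iterated, then a substitution maps the set of images of the relators
  under the generated monoid into itself. Fixed relators would escape this argument, as
  their images need not be consequences of the relators.\<close>

lemma no_fixed_rels_invariant:
  assumes P: "L_presentation P" and no_fixed: "fixed_rels P = {}"
  shows "invariant_L_pres P"
  unfolding invariant_L_pres_def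
proof
  fix \<phi> assume \<phi>: "\<phi> \<in> substs P"
  let ?F = "free_group (gens P)"
  let ?A = "\<Union>\<sigma>\<in>generated_monoid ?F (substs P). \<sigma> ` iter_rels P"
  interpret F: group ?F by (rule group_free_group)
  have \<phi>hom: "\<phi> \<in> hom ?F ?F" using \<phi> P by (auto simp: L_presentation_def End_def)
  have K: "L_kernel P = normal_closure ?F ?A" by (simp add: L_kernel_def no_fixed)
  have "?A \<subseteq> {w \<in> carrier ?F. \<phi> w \<in> L_kernel P}"
  proof
    fix w assume w: "w \<in> ?A"
    then obtain \<sigma> r where \<sigma>: "\<sigma> \<in> generated_monoid ?F (substs P)" "r \<in> iter_rels P" "w = \<sigma> r"
      by blast
    have "\<phi> w = compose (carrier ?F) \<phi> \<sigma> r"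
      using \<sigma> P by (auto simp: L_presentation_def compose_def)
    then have "\<phi> w \<in> ?A" using generated_monoid.product[OF \<sigma>(1) \<phi>] \<sigma>(2) by blast
    then show "w \<in> {w \<in> carrier ?F. \<phi> w \<in> L_kernel P}"
      using w L_relators_carrier[OF P] L_relators_L_kernel[of P] by blast
  qed
  then have "L_kernel P \<subseteq> {w \<in> carrier ?F. \<phi> w \<in> L_kernel P}"
    unfolding K
    by (rule normal_closure_least[rotated])
      (use F.normal_vimage[OF group_free_group \<phi>hom L_kernel_normal[OF P]] K in simp)
  then show "\<phi> ` L_kernel P \<subseteq> L_kernel P" by blast
qed

section \<open>Transport to another generating set\<close>

locale change_of_generators = group G for G :: "('a, 'b) monoid_scheme" (structure) +
  fixes X Y :: "'a set" and P :: "'a L_pres" and a b :: "'a fword \<Rightarrow> 'a fword"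
  assumes P: "L_presentation_of G X P" and invariant: "invariant_L_pres P"
    and Y: "generating_set G Y"
    and a_hom: "a \<in> hom (free_group X) (free_group Y)"
    and b_hom: "b \<in> hom (free_group Y) (free_group X)"
    and eval_a: "w \<in> carrier (free_group X) \<Longrightarrow> word_eval G (a w) = word_eval G w"
    and eval_b: "w \<in> carrier (free_group Y) \<Longrightarrow> word_eval G (b w) = word_eval G w"
begin

abbreviation F :: "'a fword monoid" where "F \<equiv> free_group X"

abbreviation H :: "'a fword monoid" where "H \<equiv> free_group Y"

text \<open>A substitution \<open>\<phi>\<close> is replaced by \<open>a \<circ> \<phi> \<circ> b\<close>, which induces the same endomorphism of
  \<open>G\<close>. The relators \<open>a (b y) y\<^sup>-\<^sup>1\<close> make \<open>a \<circ> b\<close> the identity of the new group. Since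
  \<open>b \<circ> a\<close> is not the identity of the free group over \<open>X\<close>, the new substitution applied to \<open>a w\<close>
  need not give \<open>a (\<phi> w)\<close>; the last family of relators forces the two to agree in the new group.
  All relators are iterated ones, the fixed ones of \<open>P\<close> included, because this
  makes the new presentation invariant whatever the relators are.\<close>

definition transported :: "'a L_pres" where
  "transported =
     \<lparr>gens = Y, fixed_rels = {},
      substs = (\<lambda>\<phi>. restrict (a \<circ> \<phi> \<circ> b) (carrier H)) ` substs P,
      iter_rels = a ` (fixed_rels P \<union> iter_rels P)
        \<union> (\<lambda>y. a (b [(y, True)]) \<otimes>\<^bsub>H\<^esub> inv\<^bsub>H\<^esub> [(y, True)]) ` Y
        \<union> (\<lambda>(\<phi>, x). a (\<phi> [(x, True)]) \<otimes>\<^bsub>H\<^esub> inv\<^bsub>H\<^esub> a (\<phi> (b (a [(x, True)])))) `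
            (substs P \<times> X)\<rparr>"

lemma transported_simps [simp]:
  "gens transported = Y" "fixed_rels transported = {}"
  "substs transported = (\<lambda>\<phi>. restrict (a \<circ> \<phi> \<circ> b) (carrier H)) ` substs P"
  by (simp_all add: transported_def)

lemma P_facts:
  "gens P = X" "L_presentation P" "kernel F G (word_eval G) = L_kernel P"
  using P by (auto simp: L_presentation_of_def)

sublocale F: group F by (rule group_free_group)

sublocale H: group H by (rule group_free_group)

sublocale eval_X: group_hom F G "word_eval G"
  using P by unfold_locales
    (auto simp: L_presentation_of_def generating_set_def intro: word_eval_hom)

sublocale eval_Y: group_hom H G "word_eval G"
  using Y by unfold_locales (auto simp: generating_set_def intro: word_eval_hom)

sublocale a: group_hom F H a by unfold_locales (rule a_hom)

sublocale b: group_hom H F b by unfold_locales (rule b_hom)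

lemma relators_P_carrier: "fixed_rels P \<union> iter_rels P \<subseteq> carrier F"
  using P_facts by (simp add: L_presentation_def)

lemma relators_P_kernel: "fixed_rels P \<union> iter_rels P \<subseteq> kernel F G (word_eval G)"
  using L_relators_L_kernel[of P] iter_rels_L_kernel[of P] P_facts by auto

lemma substs_hom: "\<phi> \<in> substs P \<Longrightarrow> \<phi> \<in> hom F F"
  using P_facts by (auto simp: L_presentation_def End_def)

lemma substs_closed: "\<phi> \<in> substs P \<Longrightarrow> w \<in> carrier F \<Longrightarrow> \<phi> w \<in> carrier F"
  using substs_hom[of \<phi>] by (auto simp: hom_def)

lemma substs_kernel:
  assumes "\<phi> \<in> substs P" "w \<in> kernel F G (word_eval G)"
  shows "\<phi> w \<in> kernel F G (word_eval G)"
  using invariant assms by (auto simp: invariant_L_pres_def P_facts)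

lemma substs_respect_eval:
  assumes \<phi>: "\<phi> \<in> substs P" and u: "u \<in> carrier F" and v: "v \<in> carrier F"
    and uv: "word_eval G u = word_eval G v"
  shows "word_eval G (\<phi> u) = word_eval G (\<phi> v)"
proof -
  interpret \<phi>: group_hom F F \<phi> using substs_hom[OF \<phi>] by unfold_locales
  have "u \<otimes>\<^bsub>F\<^esub> inv\<^bsub>F\<^esub> v \<in> kernel F G (word_eval G)"
    using u v uv by (simp add: kernel_def)
  then have "\<phi> (u \<otimes>\<^bsub>F\<^esub> inv\<^bsub>F\<^esub> v) \<in> kernel F G (word_eval G)"
    by (rule substs_kernel[OF \<phi>])
  then have "word_eval G (\<phi> u) \<otimes> inv (word_eval G (\<phi> v)) = \<one>"
    using u v by (simp add: kernel_def)
  then show ?thesis using u v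
    by (metis \<phi>.hom_closed eval_X.hom_closed inv_closed inv_equality inv_inv)
qed

lemma transported_relators_kernel: "iter_rels transported \<subseteq> kernel H G (word_eval G)"
proof -
  have letters: "[(x, True)] \<in> carrier F" if "x \<in> X" for x
    using that by (rule letter_in_free_group)
  have "word_eval G (\<phi> [(x, True)]) = word_eval G (\<phi> (b (a [(x, True)])))"
    if "\<phi> \<in> substs P" "x \<in> X" for \<phi> x
    using letters[OF that(2)] by (intro substs_respect_eval[OF that(1)]) (simp_all add: eval_a eval_b)
  then show ?thesis
    using relators_P_kernel letters letter_in_free_group[of _ Y True] substs_closed
    by (auto simp: transported_def kernel_def eval_a eval_b)
qed

lemma L_presentation_transported: "L_presentation transported"
  unfolding L_presentation_def
proof (intro conjI)
  have mult: "\<phi> (u \<otimes>\<^bsub>F\<^esub> v) = \<phi> u \<otimes>\<^bsub>F\<^esub> \<phi> v"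
    if "\<phi> \<in> substs P" "u \<in> carrier F" "v \<in> carrier F" for \<phi> u v
    using substs_hom[OF that(1)] that(2,3) by (auto simp: hom_def)
  show "substs transported \<subseteq> End (free_group (gens transported))"
    by (auto simp: End_def hom_def Pi_iff substs_closed mult)
  show "iter_rels transported \<subseteq> carrier (free_group (gens transported))"
    using transported_relators_kernel by (auto simp: kernel_def)
qed simp

lemma invariant_transported: "invariant_L_pres transported"
  by (rule no_fixed_rels_invariant[OF L_presentation_transported]) simp

lemma L_kernel_transported_normal: "L_kernel transported \<lhd> H"
  using L_kernel_normal[OF L_presentation_transported] by simp

lemma L_kernel_transported_subset: "L_kernel transported \<subseteq> kernel H G (word_eval G)"
proof (rule L_kernel_least[OF L_presentation_transported])
  show "kernel H G (word_eval G) \<lhd> free_group (gens transported)"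
    using eval_Y.normal_kernel by simp
  fix \<psi> assume "\<psi> \<in> substs transported"
  then obtain \<phi> where \<phi>: "\<phi> \<in> substs P" "\<psi> = restrict (a \<circ> \<phi> \<circ> b) (carrier H)"
    by auto
  show "\<psi> ` kernel H G (word_eval G) \<subseteq> kernel H G (word_eval G)"
  proof (intro image_subsetI)
    fix w assume w: "w \<in> kernel H G (word_eval G)"
    then have "b w \<in> kernel F G (word_eval G)" by (auto simp: kernel_def eval_b)
    then have "\<phi> (b w) \<in> kernel F G (word_eval G)" by (rule substs_kernel[OF \<phi>(1)])
    then show "\<psi> w \<in> kernel H G (word_eval G)"
      using w by (auto simp: \<phi>(2) kernel_def eval_a)
  qed
qed (simp_all add: transported_relators_kernel)

text \<open>The preimage under \<open>a\<close> of the new kernel contains the relators of \<open>P\<close>, so it is enough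
  that it is closed under the substitutions of \<open>P\<close>. If \<open>a w\<close> lies in the new kernel, then so does
  \<open>a (\<phi> (b (a w)))\<close> by invariance, and the last family of relators of the transported
  presentation turns this into \<open>a (\<phi> w)\<close>.\<close>

lemma a_L_kernel:
  assumes "w \<in> L_kernel P"
  shows "a w \<in> L_kernel transported"
proof -
  let ?M = "{w \<in> carrier F. a w \<in> L_kernel transported}"
  have iter: "iter_rels transported \<subseteq> L_kernel transported"
    by (rule iter_rels_L_kernel[OF L_presentation_transported])
  have "L_kernel P \<subseteq> ?M"
  proof (rule L_kernel_least[OF P_facts(2)])
    show "?M \<lhd> free_group (gens P)"
      using H.normal_vimage[OF F.is_group a_hom L_kernel_transported_normal] by (simp add: P_facts)
    show "fixed_rels P \<subseteq> ?M" "iter_rels P \<subseteq> ?M"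
      using relators_P_carrier iter by (auto simp: transported_def)
    fix \<phi> assume \<phi>: "\<phi> \<in> substs P"
    show "\<phi> ` ?M \<subseteq> ?M"
    proof (intro image_subsetI)
      fix w assume "w \<in> ?M"
      then have w: "w \<in> carrier F" "a w \<in> L_kernel transported" by auto
      have "restrict (a \<circ> \<phi> \<circ> b) (carrier H) ` L_kernel transported \<subseteq> L_kernel transported"
        using invariant_transported \<phi> unfolding invariant_L_pres_def transported_simps by blast
      then have "restrict (a \<circ> \<phi> \<circ> b) (carrier H) (a w) \<in> L_kernel transported"
        using w(2) by blast
      then have "(a \<circ> (\<phi> \<circ> (b \<circ> a))) w \<in> L_kernel transported" using w(1) by simp
      moreover have "(a \<circ> \<phi>) w \<in> L_kernel transported \<longleftrightarrow>
          (a \<circ> (\<phi> \<circ> (b \<circ> a))) w \<in> L_kernel transported"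
      proof (rule H.free_group_hom_congruent[OF _ _ L_kernel_transported_normal _ w(1)])
        show "a \<circ> \<phi> \<in> hom F H"
          by (rule Group.hom_compose[OF substs_hom[OF \<phi>] a_hom])
        show "a \<circ> (\<phi> \<circ> (b \<circ> a)) \<in> hom F H"
          by (rule Group.hom_compose[OF Group.hom_compose[OF
                Group.hom_compose[OF a_hom b_hom] substs_hom[OF \<phi>]] a_hom])
        fix x assume "x \<in> X"
        with \<phi> have "a (\<phi> [(x, True)]) \<otimes>\<^bsub>H\<^esub> inv\<^bsub>H\<^esub> a (\<phi> (b (a [(x, True)]))) \<in> iter_rels transported"
          by (force simp: transported_def)
        then show "(a \<circ> \<phi>) [(x, True)] \<otimes>\<^bsub>H\<^esub> inv\<^bsub>H\<^esub> (a \<circ> (\<phi> \<circ> (b \<circ> a))) [(x, True)]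
            \<in> L_kernel transported"
          using iter by auto
      qed
      ultimately show "\<phi> w \<in> ?M" using w substs_closed[OF \<phi>] by simp
    qed
  qed
  then show ?thesis using assms by blast
qed

text \<open>A word \<open>h\<close> that is trivial in \<open>G\<close> has \<open>b h\<close> in the kernel of \<open>P\<close>, hence \<open>a (b h)\<close> in the new
  kernel, and \<open>a (b h)\<close> agrees with \<open>h\<close> modulo the relators \<open>a (b y) y\<^sup>-\<^sup>1\<close>.\<close>

lemma kernel_subset_L_kernel_transported: "kernel H G (word_eval G) \<subseteq> L_kernel transported"
proof
  fix h assume h: "h \<in> kernel H G (word_eval G)"
  then have "b h \<in> L_kernel P" by (auto simp: P_facts(3)[symmetric] kernel_def eval_b)
  then have "(a \<circ> b) h \<in> L_kernel transported" by (simp add: a_L_kernel)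
  moreover have "(a \<circ> b) h \<in> L_kernel transported \<longleftrightarrow> id h \<in> L_kernel transported"
  proof (rule H.free_group_hom_congruent[where f = "a \<circ> b" and g = id,
        OF _ _ L_kernel_transported_normal])
    show "a \<circ> b \<in> hom H H" by (rule Group.hom_compose[OF b_hom a_hom])
    show "id \<in> hom H H" by (simp add: hom_def)
    show "h \<in> carrier H" using h by (simp add: kernel_def)
    fix y assume "y \<in> Y"
    then have "a (b [(y, True)]) \<otimes>\<^bsub>H\<^esub> inv\<^bsub>H\<^esub> [(y, True)] \<in> iter_rels transported"
      by (auto simp: transported_def)
    then show "(a \<circ> b) [(y, True)] \<otimes>\<^bsub>H\<^esub> inv\<^bsub>H\<^esub> (id [(y, True)]) \<in> L_kernel transported"
      using iter_rels_L_kernel[OF L_presentation_transported] by auto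
  qed
  ultimately show "h \<in> L_kernel transported" by simp
qed

lemma L_presentation_of_transported: "L_presentation_of G Y transported"
  using Y L_presentation_transported L_kernel_transported_subset kernel_subset_L_kernel_transported
  by (auto simp: L_presentation_of_def)

lemma finite_transported: "finite_L_pres P \<Longrightarrow> finite Y \<Longrightarrow> finite_L_pres transported"
  by (simp add: finite_L_pres_def transported_def P_facts)

end

theorem theoremB:
  fixes G :: "('a, 'b) monoid_scheme"
  assumes "group G"
    and "\<exists>X. finite X \<and> generating_set G X \<and> admits_invariant_finite_L_pres G X"
  shows "\<forall>Y. finite Y \<and> generating_set G Y \<longrightarrow> admits_invariant_finite_L_pres G Y"
proof (intro allI impI)
  fix Y assume "finite Y \<and> generating_set G Y"
  then have finite_Y: "finite Y" and Y: "generating_set G Y" by auto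
  interpret group G by fact
  obtain X P where X: "generating_set G X" and P: "L_presentation_of G X P" "invariant_L_pres P"
    and P_finite: "finite_L_pres P"
    using assms(2) by (auto simp: admits_invariant_finite_L_pres_def)
  have sub: "X \<subseteq> carrier G" "Y \<subseteq> carrier G" using X Y by (auto simp: generating_set_def)
  obtain a where a: "a \<in> hom (free_group X) (free_group Y)"
    "\<And>w. w \<in> carrier (free_group X) \<Longrightarrow> word_eval G (a w) = word_eval G w"
    using change_of_generators_lift[OF sub(1)] Y by blast
  obtain b where b: "b \<in> hom (free_group Y) (free_group X)"
    "\<And>w. w \<in> carrier (free_group Y) \<Longrightarrow> word_eval G (b w) = word_eval G w"
    using change_of_generators_lift[OF sub(2) X] by blast
  interpret change_of_generators G X Y P a b
    using P Y a b by unfold_locales auto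
  show "admits_invariant_finite_L_pres G Y"
    unfolding admits_invariant_finite_L_pres_def
    using L_presentation_of_transported invariant_transported
      finite_transported[OF P_finite finite_Y] by blast
qed

end
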